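(* Assume that $(A,B)$ is stabilizable, $(C,A)$ is detectable, and $\operatorname{Ker} C\subseteq \big(\bigcap_{i=1}^r \operatorname{Ker} A_0^i\big)\cap \operatorname{Ker} L^{\top}$, where $C^{\top}C=Q-LR^{-1}L^{\top}$ is a full rank decomposition. Let $\widehat X\ge 0$ be a solution of the stochastic continuous-time algebraic Riccati equation (SCARE) $\mathcal R(X)=0$. Let $X_0$ be symmetric with $X_0\ge\widehat X$, such that $A_c(X_0)-G_c(X_0)X_0$ is stable and $\mathcal R(X_0)\le 0$. Let $\{X_k\}_{k=0}^\infty$ be the sequence starting from $X_0$ in which, for each $k\ge 0$, $X_{k+1}$ is the (unique) positive semidefinite stabilizing solution $X$ of $$A_k^{\top}X+XA_k-XG_kX+H_k=0,\qquad A_k=A_c(X_k),\ G_k=G_c(X_k),\ H_k=H_c(X_k).$$ Then: (i) for each $k\ge 0$, $X_k\ge X_{k+1}$, $X_k\ge\widehat X$, and $\mathcal R(X_k)\le 0$; (ii) $\lim_{k\to\infty}X_k=\widehat X_+$, where $\widehat X_+\ge\widehat X$ is a solution of the SCARE $\mathcal R(X)=0$; (iii) $\sigma\big(A_c(\widehat X_+)-G_c(\widehat X_+)\widehat X_+\big)\subset\mathbb C_-\cup i\mathbb R$.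
   Context: Data: $A,A_0^i\in\mathbb R^{n\times n}$, $B,B_0^i\in\mathbb R^{n\times m}$ ($i=1,\dots,r$), $Q=Q^{\top}\in\mathbb R^{n\times n}$, $L\in\mathbb R^{n\times m}$, $R=R^{\top}\in\mathbb R^{m\times m}$ with $R>0$ and $Q-LR^{-1}L^{\top}\ge 0$. For symmetric matrices, $X\ge Y$ (resp. $X>Y$) means $X-Y$ is positive semidefinite (resp. positive definite). For symmetric $X\in\mathbb R^{n\times n}$: $\Pi_{11}(X)=\sum_{i=1}^r A_0^{i\top}XA_0^i$, $\Pi_{12}(X)=\sum_{i=1}^r A_0^{i\top}XB_0^i$, $\Pi_{22}(X)=\sum_{i=1}^r B_0^{i\top}XB_0^i$; $L_c(X)=L+\Pi_{12}(X)$, $R_c(X)=R+\Pi_{22}(X)$, $Q_c(X)=Q+\Pi_{11}(X)$. For $X\ge0$ one has $R_c(X)>0$ and $A_c(X)=A-BR_c(X)^{-1}L_c(X)^{\top}$, $G_c(X)=BR_c(X)^{-1}B^{\top}$, $H_c(X)=Q_c(X)-L_c(X)R_c(X)^{-1}L_c(X)^{\top}$, $\mathcal R(X)=A_c(X)^{\top}X+XA_c(X)-XG_c(X)X+H_c(X)$. A square matrix is stable if all its eigenvalues lie in the open left half-plane $\mathbb C_-$; $\sigma(\cdot)$ is the spectrum. $(A,B)$ is stabilizable if $y^{*}A=\lambda y^{*}$, $\operatorname{Re}\lambda\ge0$, $y^{*}B=0$ imply $y=0$; $(C,A)$ is detectable if $Ax=\lambda x$, $\operatorname{Re}\lambda\ge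 0$, $Cx=0$ imply $x=0$. A solution $X$ of $A_k^{\top}X+XA_k-XG_kX+H_k=0$ is stabilizing if $A_k-G_kX$ is stable. *)

theory Defs
  imports "HOL-Analysis.Analysis"
begin

definition pos_semidef :: "real^'n^'n \<Rightarrow> bool" where
  "pos_semidef X \<longleftrightarrow> transpose X = X \<and> (\<forall>v. 0 \<le> v \<bullet> (X *v v))"

definition pos_def :: "real^'n^'n \<Rightarrow> bool" where
  "pos_def X \<longleftrightarrow> transpose X = X \<and> (\<forall>v. v \<noteq> 0 \<longrightarrow> 0 < v \<bullet> (X *v v))"

text \<open>The Loewner order. The library order on vectors is componentwise, so it cannot be used
  for matrices here.\<close>

definition loewner_le :: "real^'n^'n \<Rightarrow> real^'n^'n \<Rightarrow> bool"  (infix "\<preceq>" 50) where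
  "Y \<preceq> X \<longleftrightarrow> pos_semidef (X - Y)"

definition cmat :: "real^'n^'m \<Rightarrow> complex^'n^'m" where
  "cmat M = map_matrix complex_of_real M"

definition spectrum :: "real^'n^'n \<Rightarrow> complex set" where
  "spectrum M = {z. \<exists>v. v \<noteq> 0 \<and> cmat M *v v = z *s v}"

definition stable :: "real^'n^'n \<Rightarrow> bool" where
  "stable M \<longleftrightarrow> spectrum M \<subseteq> {z. Re z < 0}"

text \<open>The row vector \<open>y\<^sup>*\<close> is the componentwise conjugate of \<open>y\<close>, multiplied from the left by \<open>v*\<close>.\<close>

definition vec_cnj :: "complex^'n \<Rightarrow> complex^'n" where
  "vec_cnj y = (\<chi> i. cnj (y $ i))"

definition stabilizable :: "real^'n^'n \<Rightarrow> real^'m^'n \<Rightarrow> bool" where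
  "stabilizable A B \<longleftrightarrow>
     (\<forall>z y. vec_cnj y v* cmat A = z *s vec_cnj y \<and> 0 \<le> Re z \<and> vec_cnj y v* cmat B = 0
            \<longrightarrow> y = 0)"

definition detectable :: "real^'n^'p \<Rightarrow> real^'n^'n \<Rightarrow> bool" where
  "detectable C A \<longleftrightarrow>
     (\<forall>z x. cmat A *v x = z *s x \<and> 0 \<le> Re z \<and> cmat C *v x = 0 \<longrightarrow> x = 0)"

definition mat_ker :: "real^'n^'m \<Rightarrow> (real^'n) set" where
  "mat_ker M = {x. M *v x = 0}"

text \<open>\<open>W = C\<^sup>T C\<close> where \<open>C\<close> has full row rank \<open>CARD('p)\<close>, necessarily equal to the rank of \<open>W\<close>.
  If \<open>W = 0\<close>, then \<open>C\<close> should have no rows at all. Index types are nonempty, so in that case the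
  empty matrix is represented by a zero matrix, which has the same kernel.\<close>

definition full_rank_decomposition :: "real^'n^'n \<Rightarrow> real^'n^'p \<Rightarrow> bool" where
  "full_rank_decomposition W C \<longleftrightarrow>
     transpose C ** C = W \<and> (rank C = CARD('p) \<or> W = 0)"

text \<open>The families \<open>A0\<close>, \<open>B0\<close> are used at the indices \<open>1, \<dots>, r\<close> only.\<close>

definition Pi11 ::
  "nat \<Rightarrow> (nat \<Rightarrow> real^'n^'n) \<Rightarrow> real^'n^'n \<Rightarrow> real^'n^'n" where
  "Pi11 r A0 X = (\<Sum>i=1..r. transpose (A0 i) ** X ** A0 i)"

definition Pi12 ::
  "nat \<Rightarrow> (nat \<Rightarrow> real^'n^'n) \<Rightarrow> (nat \<Rightarrow> real^'m^'n) \<Rightarrow> real^'n^'n \<Rightarrow> real^'m^'n" where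
  "Pi12 r A0 B0 X = (\<Sum>i=1..r. transpose (A0 i) ** X ** B0 i)"

definition Pi22 ::
  "nat \<Rightarrow> (nat \<Rightarrow> real^'m^'n) \<Rightarrow> real^'n^'n \<Rightarrow> real^'m^'m" where
  "Pi22 r B0 X = (\<Sum>i=1..r. transpose (B0 i) ** X ** B0 i)"

definition Lc ::
  "nat \<Rightarrow> (nat \<Rightarrow> real^'n^'n) \<Rightarrow> (nat \<Rightarrow> real^'m^'n) \<Rightarrow> real^'m^'n \<Rightarrow> real^'n^'n \<Rightarrow> real^'m^'n" where
  "Lc r A0 B0 L X = L + Pi12 r A0 B0 X"

definition Rc ::
  "nat \<Rightarrow> (nat \<Rightarrow> real^'m^'n) \<Rightarrow> real^'m^'m \<Rightarrow> real^'n^'n \<Rightarrow> real^'m^'m" where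
  "Rc r B0 R X = R + Pi22 r B0 X"

definition Qc ::
  "nat \<Rightarrow> (nat \<Rightarrow> real^'n^'n) \<Rightarrow> real^'n^'n \<Rightarrow> real^'n^'n \<Rightarrow> real^'n^'n" where
  "Qc r A0 Q X = Q + Pi11 r A0 X"

definition Ac ::
  "nat \<Rightarrow> real^'n^'n \<Rightarrow> real^'m^'n \<Rightarrow> (nat \<Rightarrow> real^'n^'n) \<Rightarrow> (nat \<Rightarrow> real^'m^'n) \<Rightarrow> real^'m^'n \<Rightarrow> real^'m^'m \<Rightarrow> real^'n^'n \<Rightarrow> real^'n^'n" where
  "Ac r A B A0 B0 L R X = A - B ** matrix_inv (Rc r B0 R X) ** transpose (Lc r A0 B0 L X)"

definition Gc ::
  "nat \<Rightarrow> real^'m^'n \<Rightarrow> (nat \<Rightarrow> real^'m^'n) \<Rightarrow> real^'m^'m \<Rightarrow> real^'n^'n \<Rightarrow> real^'n^'n" where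
  "Gc r B B0 R X = B ** matrix_inv (Rc r B0 R X) ** transpose B"

definition Hc ::
  "nat \<Rightarrow> (nat \<Rightarrow> real^'n^'n) \<Rightarrow> (nat \<Rightarrow> real^'m^'n) \<Rightarrow> real^'n^'n \<Rightarrow> real^'m^'n \<Rightarrow> real^'m^'m \<Rightarrow> real^'n^'n \<Rightarrow> real^'n^'n" where
  "Hc r A0 B0 Q L R X = Qc r A0 Q X - Lc r A0 B0 L X ** matrix_inv (Rc r B0 R X) ** transpose (Lc r A0 B0 L X)"

definition Ric ::
  "nat \<Rightarrow> real^'n^'n \<Rightarrow> real^'m^'n \<Rightarrow> (nat \<Rightarrow> real^'n^'n) \<Rightarrow> (nat \<Rightarrow> real^'m^'n) \<Rightarrow> real^'n^'n \<Rightarrow> real^'m^'n \<Rightarrow> real^'m^'m \<Rightarrow> real^'n^'n \<Rightarrow> real^'n^'n" where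
  "Ric r A B A0 B0 Q L R X =
     transpose (Ac r A B A0 B0 L R X) ** X + X ** Ac r A B A0 B0 L R X
       - X ** Gc r B B0 R X ** X + Hc r A0 B0 Q L R X"

definition care_solution ::
  "real^'n^'n \<Rightarrow> real^'n^'n \<Rightarrow> real^'n^'n \<Rightarrow> real^'n^'n \<Rightarrow> bool" where
  "care_solution A G H X \<longleftrightarrow> transpose A ** X + X ** A - X ** G ** X + H = 0"

definition stabilizing_care_solution ::
  "real^'n^'n \<Rightarrow> real^'n^'n \<Rightarrow> real^'n^'n \<Rightarrow> real^'n^'n \<Rightarrow> bool" where
  "stabilizing_care_solution A G H X \<longleftrightarrow> care_solution A G H X \<and> stable (A - G ** X)"

end

theory Submission
  imports Defs "HOL-Computational_Algebra.Fundamental_Theorem_Algebra"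
begin

text \<open>The CARE residual at \<open>X\<close> with coefficients evaluated at \<open>Y \<succeq> 0\<close> is the minimum over the control
  \<open>u\<close> of a Hamiltonian that is monotone in \<open>Y\<close> and affine in \<open>X\<close>, attained at a linear feedback
  \<open>u = K v\<close>. Inserting the feedback of one pair \<open>(X, Y)\<close> into the Hamiltonian of another therefore
  turns every comparison of iterates into a Lyapunov inequality for \<open>A + B K\<close>, and stability of
  \<open>A + B K\<close> yields the Loewner order. Stability of the closed loop at any \<open>X \<succeq> 0\<close> with nonpositive
  Riccati residual follows from detectability: on an unstable mode the cost vanishes, so \<open>C\<close>, hence
  \<open>L\<^sup>T\<close>, hence the feedback vanishes there. The same argument applied to the limit gives the spectral
  claim, even with strict inequality. The Lyapunov theorem itself is obtained from the Cayley
  transform \<open>S = (1 + A)(1 - A)\<^sup>-\<^sup>1\<close>: the form \<open>x \<bullet> D x\<close> decreases along \<open>S\<^sup>k x\<close>, which tends to \<open>0\<close>.\<close>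

section \<open>Powers of matrices and the Lyapunov theorem\<close>

text \<open>This is the vector p(S) x. Iterates of the map on vectors stand in for powers of the
  matrix.\<close>

definition poly_act :: "complex^'n^'n \<Rightarrow> complex poly \<Rightarrow> complex^'n \<Rightarrow> complex^'n" where
  "poly_act S p x = (\<Sum>i\<le>degree p. coeff p i *s (((*v) S ^^ i) x))"

lemma poly_act_upto:
  assumes "degree p \<le> N"
  shows "poly_act S p x = (\<Sum>i\<le>N. coeff p i *s (((*v) S ^^ i) x))"
  unfolding poly_act_def
  by (rule sum.mono_neutral_left) (use assms in \<open>auto simp: coeff_eq_0\<close>)

lemma matrix_pow_diff_smult:
  fixes S :: "complex^'n^'n"
  shows "((*v) S ^^ i) (x - l *s y) = ((*v) S ^^ i) x - l *s (((*v) S ^^ i) y)"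
  by (induction i) (simp_all add: matrix_vector_mult_diff_distrib vector_scalar_commute)

text \<open>Moves a factor S - l from the polynomial to the vector, which lowers the degree in the
  induction behind \<open>matrix_pow_tendsto_0\<close>.\<close>

lemma poly_act_linear_factor:
  "poly_act S ([:-l, 1:] * p) x = poly_act S p (S *v x - l *s x)"
proof -
  \<comment> \<open>One more than the degree of \<open>p\<close>, to make room for the product. The
    extra summand vanishes in both sums below: the constant one in the shifted sum, the top one in
    the other.\<close>
  define N where "N = Suc (degree p)"
  define y where "y i = ((*v) S ^^ i) x" for i
  have "degree ([:-l, 1:] * p) \<le> N"
    unfolding N_def using degree_mult_le[of "[:-l, 1:]" p] by simp
  then have "poly_act S ([:-l, 1:] * p) x = (\<Sum>i\<le>N. coeff ([:-l, 1:] * p) i *s y i)"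
    by (simp add: poly_act_upto y_def)
  also have "\<dots> = (\<Sum>i\<le>N. coeff (pCons 0 p) i *s y i) - (\<Sum>i\<le>N. (l * coeff p i) *s y i)"
    by (simp add: sum_subtractf[symmetric] vec_eq_iff algebra_simps)
  also have "(\<Sum>i\<le>N. coeff (pCons 0 p) i *s y i) = (\<Sum>i\<le>degree p. coeff p i *s y (Suc i))"
    unfolding N_def by (subst sum.atMost_Suc_shift) simp
  also have "(\<Sum>i\<le>N. (l * coeff p i) *s y i) = (\<Sum>i\<le>degree p. (l * coeff p i) *s y i)"
    unfolding N_def by (simp add: coeff_eq_0)
  finally show ?thesis
    unfolding poly_act_def matrix_pow_diff_smult y_def
    by (simp add: sum_subtractf[symmetric] vec_eq_iff algebra_simps funpow_swap1)
qed

text \<open>Since p(S) commutes with S - l, a vector (S - l) x annihilated by p(S) makes p(S) x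
  either zero or an eigenvector for l.\<close>

lemma poly_act_diff_smult:
  "poly_act S p (S *v x - l *s x) = S *v poly_act S p x - l *s poly_act S p x"
proof -
  have "S *v poly_act S p x = poly_act S p (S *v x)"
    unfolding poly_act_def
    by (simp add: linear_sum[OF matrix_vector_mul_linear] vector_scalar_commute funpow_swap1)
  then show ?thesis
    unfolding poly_act_def matrix_pow_diff_smult
    by (simp add: sum_subtractf[symmetric] sum_distrib_left vec_eq_iff algebra_simps)
qed

text \<open>The first N + 1 vectors of the orbit cannot be independent in a space of dimension N;
  the coefficients of a dependency form the polynomial.\<close>

lemma ex_annihilating_poly: "\<exists>p. p \<noteq> 0 \<and> poly_act S p (x :: complex^'n) = 0"
proof -
  define y where "y i = ((*v) S ^^ i) x" for i
  \<comment> \<open>The real dimension, twice the number of coordinates. A dependency over the reals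
    suffices, and the degree need not be minimal.\<close>
  define N where "N = DIM(complex^'n)"
  have "\<exists>c::nat \<Rightarrow> complex. (\<exists>i\<le>N. c i \<noteq> 0) \<and> (\<Sum>i\<le>N. c i *s y i) = 0"
  proof (cases "inj_on y {..N}")
    case True
    then have "card (y ` {..N}) = Suc N" by (simp add: card_image)
    then have "dependent (y ` {..N})"
      using dependent_biggerset[of "y ` {..N}"] by (simp add: N_def)
    then obtain u where u: "\<exists>v\<in>y ` {..N}. u v \<noteq> 0" "(\<Sum>v\<in>y ` {..N}. u v *\<^sub>R v) = 0"
      using dependent_finite[of "y ` {..N}"] by blast
    from u(2) have "(\<Sum>i\<le>N. u (y i) *\<^sub>R y i) = 0"
      by (simp add: sum.reindex[OF True])
    then have "(\<Sum>i\<le>N. complex_of_real (u (y i)) *s y i) = 0"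
      by (simp add: vec_eq_iff scaleR_conv_of_real[where 'a=complex])
    then show ?thesis using u(1) by (intro exI[of _ "\<lambda>i. complex_of_real (u (y i))"]) auto
  next
    \<comment> \<open>A repeated orbit vector makes the image set too small for the dimension count,
      but the coefficients 1 and -1 at the two indices already give a dependency.\<close>
    case False
    then obtain i j where ij: "i \<le> N" "j \<le> N" "i \<noteq> j" "y i = y j"
      by (auto simp: inj_on_def)
    have "(\<Sum>k\<le>N. ((if k = i then 1 else 0) - (if k = j then 1 else 0)) *s y k) = y i - y j"
      using ij by (simp add: vec_eq_iff left_diff_distrib sum_subtractf if_distrib[of "\<lambda>c. c * _"] cong: if_cong)
    then show ?thesis
      using ij by (intro exI[of _ "\<lambda>k. (if k = i then 1 else 0) - (if k = j then 1 else 0)"]) auto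
  qed
  then obtain c :: "nat \<Rightarrow> complex" and i where c: "i \<le> N" "c i \<noteq> 0" "(\<Sum>i\<le>N. c i *s y i) = 0" by blast
  define p where "p = (\<Sum>i\<le>N. monom (c i) i)"
  have coeff: "coeff p k = (if k \<le> N then c k else 0)" for k
    unfolding p_def by (auto simp: coeff_sum if_distrib cong: if_cong)
  have "degree p \<le> N" by (rule degree_le) (simp add: coeff)
  then have "poly_act S p x = 0" using c(3) by (simp add: poly_act_upto coeff y_def)
  moreover have "p \<noteq> 0" using c(1,2) coeff[of i] by auto
  ultimately show ?thesis by blast
qed

lemma linear_recurrence_tendsto_0:
  fixes y w :: "nat \<Rightarrow> complex"
  assumes rec: "\<And>k. y (Suc k) = l * y k + w k" and l: "norm l < 1" and w: "w \<longlonglongrightarrow> 0"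
  shows "y \<longlonglongrightarrow> 0"
proof (rule LIMSEQ_I)
  fix e :: real assume e: "0 < e"
  \<comment> \<open>With perturbations below this threshold, e/2 is a fixed point of the resulting
    bound t -> |l| t + (1 - |l|) e/2, so only a geometric term is added to it.\<close>
  have "0 < e / 2 * (1 - norm l)" using e l by simp
  from LIMSEQ_D[OF w this] obtain N where N: "\<And>k. k \<ge> N \<Longrightarrow> norm (w k) < e / 2 * (1 - norm l)"
    by auto
  have bound: "norm (y (N + j)) \<le> norm l ^ j * norm (y N) + e / 2" for j
  proof (induction j)
    case 0 then show ?case using e by simp
  next
    case (Suc j)
    have "norm (y (N + Suc j)) \<le> norm l * norm (y (N + j)) + norm (w (N + j))"
      using norm_triangle_ineq[of "l * y (N + j)"] by (simp add: rec norm_mult)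
    also have "\<dots> \<le> norm l * (norm l ^ j * norm (y N) + e / 2) + e / 2 * (1 - norm l)"
      using N[of "N + j"] by (intro add_mono mult_left_mono Suc) auto
    finally show ?case by (simp add: field_simps)
  qed
  have "(\<lambda>j. norm l ^ j * norm (y N)) \<longlonglongrightarrow> 0"
    using l by (intro tendsto_mult_left_zero LIMSEQ_power_zero) auto
  then obtain M where M: "\<And>j. j \<ge> M \<Longrightarrow> norm l ^ j * norm (y N) < e / 2"
    using e LIMSEQ_D[of "\<lambda>j. norm l ^ j * norm (y N)" 0 "e/2"] by fastforce
  have "norm (y n - 0) < e" if "n \<ge> N + M" for n
  proof -
    have "M \<le> n - N" using that by simp
    from M[OF this] bound[of "n - N"] that show ?thesis by simp
  qed
  then show "\<exists>no. \<forall>n\<ge>no. norm (y n - 0) < e" by blast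
qed

text \<open>Induction on the degree of a polynomial \<open>p\<close> with \<open>p(S) x = 0\<close>: for a root \<open>l\<close> with \<open>norm l < 1\<close>
  the orbit of \<open>x\<close> obeys a contracting recurrence driven by the orbit of \<open>(S - l) x\<close>; any other root
  can be cancelled from \<open>p\<close>, as \<open>S - l\<close> is injective.\<close>

lemma matrix_pow_tendsto_0:
  fixes S :: "complex^'n^'n"
  assumes eig: "\<And>z v. v \<noteq> 0 \<Longrightarrow> S *v v = z *s v \<Longrightarrow> norm z < 1"
  shows "(\<lambda>k. ((*v) S ^^ k) x) \<longlonglongrightarrow> 0"
proof -
  have "(\<lambda>k. ((*v) S ^^ k) x) \<longlonglongrightarrow> 0"
    if "p \<noteq> 0" "poly_act S p x = 0" "degree p = d" for p x d
    using that
  proof (induction d arbitrary: p x)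
    case 0
    then obtain c where "p = [:c:]" "c \<noteq> 0" by (auto elim: degree_eq_zeroE)
    with 0 have "x = 0" by (simp add: poly_act_def)
    moreover have "((*v) S ^^ k) 0 = 0" for k by (induction k) auto
    ultimately show ?case by simp
  next
    case (Suc d)
    have "\<not> constant (poly p)" using Suc.prems by (simp add: constant_degree)
    then obtain l where "poly p l = 0" using fundamental_theorem_of_algebra by blast
    then obtain q where q: "p = [:-l, 1:] * q" by (auto simp: poly_eq_0_iff_dvd)
    have q0: "q \<noteq> 0" using q Suc.prems by auto
    have "degree p = Suc (degree q)" unfolding q using q0 by (subst degree_mult_eq) auto
    then have qd: "degree q = d" using Suc.prems by simp
    have act: "poly_act S q (S *v x - l *s x) = 0"
      using Suc.prems(2) unfolding q poly_act_linear_factor .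
    show ?case
    proof (cases "norm l < 1")
      case True
      define y where "y k = ((*v) S ^^ k) x" for k
      define w where "w k = ((*v) S ^^ k) (S *v x - l *s x)" for k
      have w: "w \<longlonglongrightarrow> 0" unfolding w_def by (rule Suc.IH[OF q0 act qd])
      have rec: "y (Suc k) = l *s y k + w k" for k
        unfolding y_def w_def matrix_pow_diff_smult by (simp add: funpow_swap1)
      have "(\<lambda>k. y k $ i) \<longlonglongrightarrow> 0" for i
      proof (rule linear_recurrence_tendsto_0[OF _ True])
        show "y (Suc k) $ i = l * y k $ i + w k $ i" for k by (simp add: rec)
        show "(\<lambda>k. w k $ i) \<longlonglongrightarrow> 0" using tendsto_vec_nth[OF w, of i] by simp
      qed
      then have "y \<longlonglongrightarrow> 0" by (intro vec_tendstoI) simp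
      then show ?thesis by (simp add: y_def[abs_def])
    next
      case False
      have "S *v poly_act S q x = l *s poly_act S q x"
        using act by (simp add: poly_act_diff_smult)
      with False eig have "poly_act S q x = 0" by blast
      then show ?thesis using Suc.IH q0 qd by blast
    qed
  qed
  then show ?thesis using ex_annihilating_poly by blast
qed

section \<open>Complexification, the Cayley transform and the Lyapunov theorem\<close>

definition of_real_vec :: "real^'n \<Rightarrow> complex^'n" where
  "of_real_vec v = (\<chi> i. complex_of_real (v $ i))"

lemma of_real_vec_eq_0_iff [simp]: "of_real_vec v = 0 \<longleftrightarrow> v = 0"
  by (simp add: of_real_vec_def vec_eq_iff)

lemma cmat_of_real_vec: "cmat M *v of_real_vec v = of_real_vec (M *v v)"
  by (simp add: of_real_vec_def cmat_def matrix_vector_mult_def vec_eq_iff)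

lemma cmat_matrix_mult: "cmat (M ** N) = cmat M ** cmat N"
  by (simp add: cmat_def matrix_matrix_mult_def vec_eq_iff)

lemma cmat_add: "cmat (M + N) = cmat M + cmat N"
  by (simp add: cmat_def vec_eq_iff)

lemma cmat_diff: "cmat (M - N) = cmat M - cmat N"
  by (simp add: cmat_def vec_eq_iff)

lemma cmat_mat_1: "cmat (mat 1) = mat 1"
  by (simp add: cmat_def mat_def vec_eq_iff)

lemma stable_eigenvalue:
  assumes "stable M" "v \<noteq> 0" "cmat M *v v = z *s v"
  shows "Re z < 0"
  using assms unfolding stable_def spectrum_def by blast

lemma invertible_if_kernel_trivial:
  fixes M :: "real^'n^'n"
  assumes "\<And>v. M *v v = 0 \<Longrightarrow> v = 0"
  shows "invertible M"
  using assms by (metis invertible_left_inverse matrix_left_invertible_ker)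

lemma matrix_inv_right: "invertible M \<Longrightarrow> M ** matrix_inv M = mat 1"
  unfolding invertible_def matrix_inv_def by (metis (mono_tags, lifting) someI_ex)

text \<open>The Cayley transform carries the open left half-plane to the open unit disc: an
  eigenvalue m of S comes from the eigenvalue (m - 1)/(m + 1) of A. The inverse exists because 1 is
  not an eigenvalue of a stable matrix.\<close>

lemma stable_cayley_pow_tendsto_0:
  fixes A :: "real^'n^'n"
  assumes "stable A"
  defines "S \<equiv> (mat 1 + A) ** matrix_inv (mat 1 - A)"
  shows "invertible (mat 1 - A)" and "(\<lambda>k. ((*v) S ^^ k) x) \<longlonglongrightarrow> 0"
proof -
  show inv: "invertible (mat 1 - A)"
  proof (rule invertible_if_kernel_trivial)
    fix v assume "(mat 1 - A) *v v = 0"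
    then have "A *v v = v" by (simp add: matrix_vector_mult_diff_rdistrib)
    then have "cmat A *v of_real_vec v = 1 *s of_real_vec v" by (simp add: cmat_of_real_vec)
    from stable_eigenvalue[OF assms(1) _ this] show "v = 0" by auto
  qed
  have eig: "norm m < 1" if w: "w \<noteq> 0" "cmat S *v w = m *s w" for m w
  proof -
    define u where "u = cmat (matrix_inv (mat 1 - A)) *v w"
    have "cmat (mat 1 - A) ** cmat (matrix_inv (mat 1 - A)) = mat 1"
      by (metis cmat_matrix_mult cmat_mat_1 inv matrix_inv_right)
    then have wu: "w = u - cmat A *v u"
      unfolding u_def
      by (metis cmat_diff cmat_mat_1 matrix_vector_mul_assoc matrix_vector_mul_lid
          matrix_vector_mult_diff_rdistrib)
    have "cmat S *v w = u + cmat A *v u"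
      unfolding S_def cmat_matrix_mult u_def
      by (simp add: matrix_vector_mul_assoc[symmetric] cmat_add cmat_mat_1 matrix_vector_mult_add_rdistrib)
    then have eq: "u + cmat A *v u = m *s (u - cmat A *v u)" using w wu by simp
    have u0: "u \<noteq> 0" using w(1) wu by auto
    have eq': "(1 + m) * (cmat A *v u) $ i = (m - 1) * u $ i" for i
      using arg_cong[OF eq, of "\<lambda>v. v $ i"] by (simp add: algebra_simps)
    have m1: "1 + m \<noteq> 0"
    proof
      assume "1 + m = 0"
      then have m: "m = -1" by (simp add: add_eq_0_iff)
      have "u = 0" using eq' by (simp add: m vec_eq_iff)
      with u0 show False by simp
    qed
    have "cmat A *v u = ((m - 1) / (1 + m)) *s u"
      using eq' m1 by (simp add: vec_eq_iff field_simps)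
    from stable_eigenvalue[OF assms(1) u0 this]
    have "Re ((m - 1) / (1 + m)) < 0" .
    \<comment> \<open>Expanding the fraction by the conjugate of 1 + m leaves the numerator |m|^2 -
      1, so a negative real part means |m| < 1.\<close>
    moreover have "Re ((m - 1) / (1 + m)) = ((Re m)\<^sup>2 + (Im m)\<^sup>2 - 1) / (norm (1 + m))\<^sup>2"
      unfolding cmod_power2 by (simp add: Re_divide power2_eq_square algebra_simps)
    ultimately have "(Re m)\<^sup>2 + (Im m)\<^sup>2 < 1"
      using m1 by (simp add: divide_less_0_iff)
    then show ?thesis by (simp add: cmod_def)
  qed
  have pow: "((*v) (cmat S) ^^ k) (of_real_vec x) = of_real_vec (((*v) S ^^ k) x)" for k
    by (induction k) (simp_all add: cmat_of_real_vec)
  have "(\<lambda>k. of_real_vec (((*v) S ^^ k) x)) \<longlonglongrightarrow> 0"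
    using matrix_pow_tendsto_0[of "cmat S" "of_real_vec x"] eig by (simp add: pow)
  from tendsto_vec_nth[OF this] show "(\<lambda>k. ((*v) S ^^ k) x) \<longlonglongrightarrow> 0"
    by (intro vec_tendstoI) (simp add: of_real_vec_def tendsto_of_real_iff[of _ 0, simplified])
qed

lemma inner_transpose_mult: "v \<bullet> (transpose M *v w) = (M *v v) \<bullet> (w :: real^'n)"
  by (metis dot_lmul_matrix inner_commute transpose_matrix_vector)

lemma symmetric_inner:
  fixes D :: "real^'n^'n"
  assumes "transpose D = D" shows "v \<bullet> (D *v w) = (D *v v) \<bullet> w"
  using inner_transpose_mult[of v D w] assms by simp

lemma lyapunov_pos_semidef:
  fixes A D :: "real^'n^'n"
  assumes st: "stable A" and sym: "transpose D = D"
    and dissip: "\<And>v. v \<bullet> (D *v (A *v v)) \<le> 0"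
  shows "pos_semidef D"
  unfolding pos_semidef_def
proof (intro conjI sym allI)
  fix x :: "real^'n"
  define T where "T = matrix_inv (mat 1 - A)"
  define S where "S = (mat 1 + A) ** T"
  have step: "(S *v y) \<bullet> (D *v (S *v y)) \<le> y \<bullet> (D *v y)" for y
  proof -
    \<comment> \<open>With y = (1 - A) z and S y = (1 + A) z, the two values of the form differ only
      in the mixed terms, which add up to 4 z . D A z.\<close>
    define z where "z = T *v y"
    have "(mat 1 - A) ** T = mat 1"
      unfolding T_def by (rule matrix_inv_right[OF stable_cayley_pow_tendsto_0(1)[OF st]])
    then have y: "y = z - A *v z"
      unfolding z_def by (metis matrix_vector_mul_assoc matrix_vector_mul_lid matrix_vector_mult_diff_rdistrib)
    have Sy: "S *v y = z + A *v z"
      unfolding S_def z_def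
      by (simp add: matrix_vector_mul_assoc[symmetric] matrix_vector_mult_add_rdistrib)
    have "(A *v z) \<bullet> (D *v z) = z \<bullet> (D *v (A *v z))"
      using symmetric_inner[OF sym, of z "A *v z"] by (simp add: inner_commute)
    then have "(S *v y) \<bullet> (D *v (S *v y)) = y \<bullet> (D *v y) + 4 * (z \<bullet> (D *v (A *v z)))"
      unfolding Sy unfolding y by (simp add: algebra_simps inner_simps)
    then show ?thesis using dissip[of z] by simp
  qed
  define y where "y k = ((*v) S ^^ k) x" for k
  have mono: "y k \<bullet> (D *v y k) \<le> x \<bullet> (D *v x)" for k
    by (induction k) (auto simp: y_def intro: order_trans[OF step])
  have "y \<longlonglongrightarrow> 0"
    unfolding y_def[abs_def] S_def T_def by (rule stable_cayley_pow_tendsto_0(2)[OF st])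
  moreover from this have "(\<lambda>k. D *v y k) \<longlonglongrightarrow> D *v 0"
    by (intro bounded_linear.tendsto[OF matrix_vector_mul_bounded_linear])
  ultimately have "(\<lambda>k. y k \<bullet> (D *v y k)) \<longlonglongrightarrow> 0"
    using tendsto_inner by fastforce
  then show "0 \<le> x \<bullet> (D *v x)"
    by (rule LIMSEQ_le_const2) (use mono in auto)
qed

section \<open>Matrix inverses, limits and the Loewner order\<close>

lemma pos_def_invertible:
  assumes "pos_def M" shows "invertible M"
  by (rule invertible_if_kernel_trivial) (use assms in \<open>force simp: pos_def_def\<close>)

lemma symmetric_matrix_inv:
  fixes M :: "real^'n^'n"
  assumes "invertible M" "transpose M = M"
  shows "transpose (matrix_inv M) = matrix_inv M"
proof -
  have "transpose (matrix_inv M) ** M = mat 1"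
    by (metis assms matrix_inv_right matrix_transpose_mul transpose_mat)
  then show ?thesis
    by (metis assms(1) matrix_inv_right matrix_mul_assoc matrix_mul_lid matrix_mul_rid)
qed

text \<open>By Cramer's rule each entry of the inverse is a quotient of determinants, hence
  continuous where the denominator does not vanish.\<close>

lemma tendsto_matrix_inv:
  fixes M :: "'a \<Rightarrow> real^'n^'n"
  assumes lim: "(M \<longlongrightarrow> N) F" and inv: "\<And>k. invertible (M k)" "invertible N"
  shows "((\<lambda>k. matrix_inv (M k)) \<longlongrightarrow> matrix_inv N) F"
proof -
  \<comment> \<open>The numerator in Cramer's rule for entry (k, j) of the inverse: column k of
    \<open>P\<close> is replaced by the j-th unit vector.\<close>
  define cof where "cof P j k = det (\<chi> i l. if l = k then axis j 1 $ i else P $ i $ l)"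
    for P :: "real^'n^'n" and j k
  have entry: "matrix_inv P $ k $ j = cof P j k / det P" if "invertible P" for P :: "real^'n^'n" and k j
  proof -
    have "P *v (matrix_inv P *v axis j 1) = axis j 1"
      by (simp add: matrix_vector_mul_assoc matrix_inv_right[OF that])
    then have "matrix_inv P *v axis j 1 = (\<chi> k. cof P j k / det P)"
      using that unfolding cof_def by (subst (asm) cramer) (simp_all add: invertible_det_nz)
    then show ?thesis
      by (metis (no_types, lifting) column_def matrix_vector_mult_basis vec_lambda_beta)
  qed
  have ent: "((\<lambda>k. M k $ i $ j) \<longlongrightarrow> N $ i $ j) F" for i j
    using lim by (intro tendsto_vec_nth)
  have "((\<lambda>k. cof (M k) j l / det (M k)) \<longlongrightarrow> cof N j l / det N) F" for j l
    unfolding cof_def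
  proof (intro tendsto_divide)
    show "det N \<noteq> 0" using inv(2) by (simp add: invertible_det_nz)
    show "((\<lambda>k. det (M k)) \<longlongrightarrow> det N) F"
      unfolding det_def by (intro tendsto_intros ent)
    show "((\<lambda>k. det (\<chi> i m. if m = l then axis j 1 $ i else M k $ i $ m))
      \<longlongrightarrow> det (\<chi> i m. if m = l then axis j 1 $ i else N $ i $ m)) F"
      unfolding det_def by (intro tendsto_intros) (auto intro: ent)
  qed
  then show ?thesis
    by (intro vec_tendstoI) (simp add: entry inv)
qed

lemma tendsto_matrix_mult:
  fixes M :: "'a \<Rightarrow> real^'n^'m" and N :: "'a \<Rightarrow> real^'p^'n"
  assumes "(M \<longlongrightarrow> M') F" "(N \<longlongrightarrow> N') F"
  shows "((\<lambda>k. M k ** N k) \<longlongrightarrow> M' ** N') F"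
  unfolding matrix_matrix_mult_def
  by (intro vec_tendstoI) (auto intro!: tendsto_sum tendsto_mult tendsto_vec_nth assms)

lemma tendsto_transpose:
  fixes M :: "'a \<Rightarrow> real^'n^'m"
  assumes "(M \<longlongrightarrow> M') F"
  shows "((\<lambda>k. transpose (M k)) \<longlongrightarrow> transpose M') F"
  unfolding transpose_def
  by (intro vec_tendstoI) (auto intro!: tendsto_vec_nth assms)

lemma tendsto_quadratic_form:
  fixes M :: "'a \<Rightarrow> real^'n^'n"
  assumes "(M \<longlongrightarrow> M') F"
  shows "((\<lambda>k. v \<bullet> (M k *v v)) \<longlongrightarrow> v \<bullet> (M' *v v)) F"
  unfolding matrix_vector_mult_def inner_vec_def
  by (auto intro!: tendsto_intros assms tendsto_vec_nth)

lemma pos_semidef_limit: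
  assumes "M \<longlonglongrightarrow> M'" "\<And>k. pos_semidef (M k)"
  shows "pos_semidef M'"
  unfolding pos_semidef_def
proof (intro conjI allI)
  show "transpose M' = M'"
    using tendsto_transpose[OF assms(1)] assms(2)
    by (auto simp: pos_semidef_def intro: LIMSEQ_unique[OF _ assms(1)])
  show "0 \<le> v \<bullet> (M' *v v)" for v
    by (rule LIMSEQ_le_const[OF tendsto_quadratic_form[OF assms(1)]])
      (use assms(2) in \<open>auto simp: pos_semidef_def\<close>)
qed

text \<open>Every quadratic form along the sequence is decreasing and bounded below, hence
  convergent; by polarization the entries converge as well.\<close>

lemma loewner_decreasing_convergent:
  fixes X :: "nat \<Rightarrow> real^'n^'n"
  assumes sym: "\<And>k. transpose (X k) = X k"
    and dec: "\<And>k. X (Suc k) \<preceq> X k" and bound: "\<And>k. Y \<preceq> X k"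
  shows "convergent X"
proof -
  have quad: "convergent (\<lambda>k. v \<bullet> (X k *v v))" for v
  proof -
    have "decseq (\<lambda>k. v \<bullet> (X k *v v))"
      using dec by (intro decseq_SucI) (simp add: loewner_le_def pos_semidef_def
          matrix_vector_mult_diff_rdistrib inner_diff_right)
    moreover have "v \<bullet> (Y *v v) \<le> v \<bullet> (X k *v v)" for k
      using bound[of k] by (simp add: loewner_le_def pos_semidef_def
          matrix_vector_mult_diff_rdistrib inner_diff_right)
    ultimately show ?thesis using decseq_convergent unfolding convergent_def by metis
  qed
  have entry: "X k $ i $ j = ((axis i 1 + axis j 1) \<bullet> (X k *v (axis i 1 + axis j 1))
      - axis i 1 \<bullet> (X k *v axis i 1) - axis j 1 \<bullet> (X k *v axis j 1)) / 2" for k i j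
  proof -
    have e: "axis a 1 \<bullet> (X k *v axis b 1) = X k $ a $ b" for a b
      by (simp add: inner_axis' matrix_vector_mult_basis column_def)
    have "X k $ j $ i = X k $ i $ j"
      by (metis sym transpose_def vec_lambda_beta)
    then show ?thesis by (simp add: matrix_vector_right_distrib inner_add_left inner_add_right e)
  qed
  have "convergent (\<lambda>k. X k $ i $ j)" for i j
    unfolding entry divide_inverse
    by (intro convergent_mult convergent_diff quad convergent_const)
  then have "\<exists>L. \<forall>i j. (\<lambda>k. X k $ i $ j) \<longlonglongrightarrow> L i j"
    unfolding convergent_def by metis
  then obtain L where "\<And>i j. (\<lambda>k. X k $ i $ j) \<longlonglongrightarrow> L i j" by blast
  then have "X \<longlonglongrightarrow> (\<chi> i j. L i j)" by (intro vec_tendstoI) simp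
  then show ?thesis by (auto simp: convergent_def)
qed

lemma matrix_mult_uminus: "(- M) *v (v :: real^'n) = - (M *v v)"
  and matrix_mult_uminus_right: "M *v (- v :: real^'n) = - (M *v v)"
  by (simp_all add: matrix_vector_mult_def vec_eq_iff sum_negf)

lemma sum_matrix_vector_mult: "(\<Sum>i\<in>I. M i) *v v = (\<Sum>i\<in>I. M i *v v)"
  by (induction I rule: infinite_finite_induct) (simp_all add: matrix_vector_mult_add_rdistrib)

lemma transpose_sum: "transpose (\<Sum>i\<in>I. M i) = (\<Sum>i\<in>I. transpose (M i))"
  by (simp add: vec_eq_iff transpose_def)

lemma transpose_add: "transpose (M + N) = transpose M + transpose N"
  by (simp add: vec_eq_iff transpose_def)

lemma transpose_diff: "transpose (M - N) = transpose M - transpose N"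
  by (simp add: vec_eq_iff transpose_def)

lemma loewner_le_quadratic_form:
  "Y \<preceq> X \<Longrightarrow> v \<bullet> (Y *v v) \<le> v \<bullet> (X *v v)"
  by (simp add: loewner_le_def pos_semidef_def matrix_vector_mult_diff_rdistrib inner_diff_right)

section \<open>Riccati residuals and Hamiltonians\<close>

locale scare =
  fixes r :: nat
    and A :: "real^'n^'n" and A0 :: "nat \<Rightarrow> real^'n^'n"
    and B :: "real^'m^'n" and B0 :: "nat \<Rightarrow> real^'m^'n"
    and Q :: "real^'n^'n" and L :: "real^'m^'n" and R :: "real^'m^'m"
  assumes Q_sym: "transpose Q = Q" and R_pos: "pos_def R"
begin

abbreviation "Rc' \<equiv> Rc r B0 R"
abbreviation "Lc' \<equiv> Lc r A0 B0 L"
abbreviation "Qc' \<equiv> Qc r A0 Q"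
abbreviation "Ac' \<equiv> Ac r A B A0 B0 L R"
abbreviation "Gc' \<equiv> Gc r B B0 R"
abbreviation "Hc' \<equiv> Hc r A0 B0 Q L R"
abbreviation "Ric' \<equiv> Ric r A B A0 B0 Q L R"

text \<open>Separates the unknown \<open>X\<close> from the point \<open>Y\<close> at which the
  coefficients are frozen. The iteration solves \<open>residual X (X k) = 0\<close> for the next
  iterate; the diagonal is the SCARE.\<close>

definition residual :: "real^'n^'n \<Rightarrow> real^'n^'n \<Rightarrow> real^'n^'n" where
  "residual X Y = transpose (Ac' Y) ** X + X ** Ac' Y - X ** Gc' Y ** X + Hc' Y"

text \<open>The minimizing feedback: \<open>u = gain X Y *v v\<close> minimizes
  \<open>hamiltonian X Y v u\<close> for symmetric \<open>X\<close> and positive semidefinite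
  \<open>Y\<close>.\<close>

definition gain :: "real^'n^'n \<Rightarrow> real^'n^'n \<Rightarrow> real^'n^'m" where
  "gain X Y = - (matrix_inv (Rc' Y) ** (transpose B ** X + transpose (Lc' Y)))"

definition cost :: "real^'n \<Rightarrow> real^'m \<Rightarrow> real" where
  "cost v u = v \<bullet> (Q *v v) + 2 * (v \<bullet> (L *v u)) + u \<bullet> (R *v u)"

text \<open>The first term is the derivative of v . X v along the drift (for symmetric
  \<open>X\<close>), the second the running cost, and the sum the contribution of the noise,
  measured by \<open>Y\<close>.\<close>

definition hamiltonian :: "real^'n^'n \<Rightarrow> real^'n^'n \<Rightarrow> real^'n \<Rightarrow> real^'m \<Rightarrow> real" where
  "hamiltonian X Y v u = 2 * (v \<bullet> (X *v (A *v v + B *v u))) + cost v u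
     + (\<Sum>i=1..r. (A0 i *v v + B0 i *v u) \<bullet> (Y *v (A0 i *v v + B0 i *v u)))"

lemma Ric_eq_residual: "Ric' X = residual X X"
  by (simp add: Ric_def residual_def)

text \<open>Puts the closed loop of the CARE into feedback form, so that a stabilizing solution
  supplies a stabilizing feedback.\<close>

lemma closed_loop_gain: "Ac' Y - Gc' Y ** X = A + B ** gain X Y"
  unfolding matrix_eq Ac_def Gc_def gain_def
  by (simp add: matrix_vector_mult_diff_rdistrib matrix_vector_mult_add_rdistrib
      matrix_vector_right_distrib matrix_vector_mul_assoc[symmetric] matrix_mult_uminus matrix_mult_uminus_right
      matrix_vector_mult_diff_distrib
      del: transpose_matrix_vector)

lemma transpose_Rc: "transpose Y = Y \<Longrightarrow> transpose (Rc' Y) = Rc' Y"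
  using R_pos by (simp add: Rc_def Pi22_def transpose_add transpose_sum pos_def_def
      matrix_transpose_mul matrix_mul_assoc)

lemma Rc_quadratic_form:
  "u \<bullet> (Rc' Y *v u) = u \<bullet> (R *v u) + (\<Sum>i=1..r. (B0 i *v u) \<bullet> (Y *v (B0 i *v u)))"
  by (simp add: Rc_def Pi22_def matrix_vector_mult_add_rdistrib inner_add_right
      sum_matrix_vector_mult inner_sum_right matrix_vector_mul_assoc[symmetric]
      inner_transpose_mult del: transpose_matrix_vector)

lemma Qc_quadratic_form:
  "v \<bullet> (Qc' Y *v v) = v \<bullet> (Q *v v) + (\<Sum>i=1..r. (A0 i *v v) \<bullet> (Y *v (A0 i *v v)))"
  by (simp add: Qc_def Pi11_def matrix_vector_mult_add_rdistrib inner_add_right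
      sum_matrix_vector_mult inner_sum_right matrix_vector_mul_assoc[symmetric]
      inner_transpose_mult del: transpose_matrix_vector)

lemma Lc_bilinear_form:
  "v \<bullet> (Lc' Y *v u) = v \<bullet> (L *v u) + (\<Sum>i=1..r. (A0 i *v v) \<bullet> (Y *v (B0 i *v u)))"
  by (simp add: Lc_def Pi12_def matrix_vector_mult_add_rdistrib inner_add_right
      sum_matrix_vector_mult inner_sum_right matrix_vector_mul_assoc[symmetric]
      inner_transpose_mult del: transpose_matrix_vector)

lemma Rc_pos_def:
  assumes "pos_semidef Y" shows "pos_def (Rc' Y)"
  unfolding pos_def_def
proof (intro conjI allI impI)
  show "transpose (Rc' Y) = Rc' Y" using assms by (simp add: transpose_Rc pos_semidef_def)
  fix u :: "real^'m" assume "u \<noteq> 0"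
  then have "0 < u \<bullet> (R *v u)" using R_pos by (simp add: pos_def_def)
  moreover have "0 \<le> (\<Sum>i=1..r. (B0 i *v u) \<bullet> (Y *v (B0 i *v u)))"
    using assms by (intro sum_nonneg) (simp add: pos_semidef_def)
  ultimately show "0 < u \<bullet> (Rc' Y *v u)" by (simp add: Rc_quadratic_form)
qed

text \<open>The Loewner order includes symmetry, so a sign of the quadratic form alone would not
  give an inequality for the residual.\<close>

lemma transpose_residual:
  assumes X: "transpose X = X" and Y: "pos_semidef Y"
  shows "transpose (residual X Y) = residual X Y"
proof -
  have Ysym: "transpose Y = Y" using Y by (simp add: pos_semidef_def)
  have J: "transpose (matrix_inv (Rc' Y)) = matrix_inv (Rc' Y)"
    using symmetric_matrix_inv[OF pos_def_invertible[OF Rc_pos_def[OF Y]] transpose_Rc[OF Ysym]] .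
  have Qc: "transpose (Qc' Y) = Qc' Y"
    using Q_sym Ysym by (simp add: Qc_def Pi11_def transpose_add transpose_sum
        matrix_transpose_mul matrix_mul_assoc)
  show ?thesis
    by (simp add: residual_def Gc_def Hc_def transpose_add transpose_diff matrix_transpose_mul
        X J Qc matrix_mul_assoc algebra_simps)
qed

text \<open>Completion of the square in \<open>u\<close>: the quadratic part is
  \<open>Rc' Y\<close>, the linear part is 2 u . (b + l) with the vectors \<open>b\<close> and
  \<open>l\<close> defined below, so the minimizer is -J (b + l).\<close>

lemma hamiltonian_eq_residual:
  assumes X: "transpose X = X" and Y: "pos_semidef Y"
  shows "hamiltonian X Y v u = v \<bullet> (residual X Y *v v)
    + (u - gain X Y *v v) \<bullet> (Rc' Y *v (u - gain X Y *v v))"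
proof -
  define J where "J = matrix_inv (Rc' Y)"
  define b where "b = transpose B *v (X *v v)"
  define l where "l = transpose (Lc' Y) *v v"
  have Ysym: "transpose Y = Y" using Y by (simp add: pos_semidef_def)
  note inv = pos_def_invertible[OF Rc_pos_def[OF Y]]
  have Jsym: "transpose J = J"
    unfolding J_def using symmetric_matrix_inv[OF inv transpose_Rc[OF Ysym]] .
  have RJ: "Rc' Y *v (J *v w) = w" for w
    by (simp add: J_def matrix_vector_mul_assoc matrix_inv_right[OF inv])
  have gain: "gain X Y *v v = - (J *v (b + l))"
    by (simp add: gain_def J_def b_def l_def matrix_vector_mult_add_rdistrib
      matrix_vector_mul_assoc[symmetric] matrix_mult_uminus del: transpose_matrix_vector)
  have XB: "v \<bullet> (X *v (B *v w)) = b \<bullet> w" for w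
    using symmetric_inner[OF X] inner_transpose_mult[of "X *v v" "transpose B" w]
    by (simp add: b_def del: transpose_matrix_vector)
  have L: "v \<bullet> (Lc' Y *v w) = l \<bullet> w" for w
    using inner_transpose_mult[of v "transpose (Lc' Y)" w]
    by (simp add: l_def del: transpose_matrix_vector)
  have Gc: "v \<bullet> ((X ** Gc' Y ** X) *v v) = b \<bullet> (J *v b)"
    by (simp add: Gc_def matrix_vector_mul_assoc[symmetric] XB J_def[symmetric] b_def[symmetric]
        del: transpose_matrix_vector)
  have Ac: "v \<bullet> ((X ** Ac' Y) *v v) = v \<bullet> (X *v (A *v v)) - b \<bullet> (J *v l)"
    by (simp add: Ac_def matrix_vector_mul_assoc[symmetric] matrix_vector_mult_diff_rdistrib
        matrix_vector_mult_diff_distrib inner_diff_right XB J_def[symmetric] l_def[symmetric]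
        del: transpose_matrix_vector)
  have AcT: "v \<bullet> ((transpose (Ac' Y) ** X) *v v) = v \<bullet> ((X ** Ac' Y) *v v)"
    by (simp add: matrix_vector_mul_assoc[symmetric] inner_transpose_mult symmetric_inner[OF X]
        inner_commute del: transpose_matrix_vector)
  have Hc: "v \<bullet> (Hc' Y *v v) = v \<bullet> (Qc' Y *v v) - l \<bullet> (J *v l)"
    by (simp add: Hc_def matrix_vector_mult_diff_rdistrib inner_diff_right J_def[symmetric]
        l_def[symmetric] matrix_vector_mul_assoc[symmetric] L del: transpose_matrix_vector)
  have "b \<bullet> (J *v l) = l \<bullet> (J *v b)"
    using symmetric_inner[OF Jsym] by (simp add: inner_commute)
  \<comment> \<open>The four products of \<open>b\<close> and \<open>l\<close> with
    \<open>J\<close>, coming from \<open>Ac'\<close>, \<open>Gc'\<close> and \<open>Hc'\<close>,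
    combine into one square.\<close>
  then have res: "v \<bullet> (residual X Y *v v)
      = 2 * (v \<bullet> (X *v (A *v v))) + v \<bullet> (Qc' Y *v v) - (b + l) \<bullet> (J *v (b + l))"
    unfolding residual_def matrix_vector_mult_add_rdistrib matrix_vector_mult_diff_rdistrib
      inner_add_right inner_diff_right AcT
    by (simp add: Gc Ac Hc algebra_simps inner_simps)
  have "(Y *v z) \<bullet> w = z \<bullet> (Y *v w)" for z w
    using symmetric_inner[OF Ysym] by simp
  then have cross: "(B0 i *v u) \<bullet> (Y *v (A0 i *v v)) = (A0 i *v v) \<bullet> (Y *v (B0 i *v u))" for i
    by (metis inner_commute)
  have "hamiltonian X Y v u = 2 * (v \<bullet> (X *v (A *v v))) + v \<bullet> (Qc' Y *v v)
      + 2 * (u \<bullet> (b + l)) + u \<bullet> (Rc' Y *v u)"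
    using L[of u] by (simp add: hamiltonian_def cost_def Rc_quadratic_form Qc_quadratic_form
        Lc_bilinear_form matrix_vector_right_distrib inner_add_left inner_add_right XB cross
        sum.distrib sum_distrib_left[symmetric] inner_commute[of u])
  moreover have "(u + J *v (b + l)) \<bullet> (Rc' Y *v (u + J *v (b + l)))
      = u \<bullet> (Rc' Y *v u) + 2 * (u \<bullet> (b + l)) + (b + l) \<bullet> (J *v (b + l))"
    using symmetric_inner[OF transpose_Rc[OF Ysym], of "J *v (b + l)" u]
    by (simp add: matrix_vector_right_distrib[of "Rc' Y"] RJ
        inner_add_left[of u] inner_add_right[of "_ + _"] inner_commute[of _ u] inner_commute[of "b + l"]
        inner_add_right[of u] inner_add_right[of "J *v (b+l)"])
  ultimately show ?thesis by (simp add: gain res)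
qed

lemma hamiltonian_gain:
  assumes "transpose X = X" "pos_semidef Y"
  shows "hamiltonian X Y v (gain X Y *v v) = v \<bullet> (residual X Y *v v)"
  by (simp add: hamiltonian_eq_residual assms)

lemma residual_le_hamiltonian:
  assumes "transpose X = X" "pos_semidef Y"
  shows "v \<bullet> (residual X Y *v v) \<le> hamiltonian X Y v u"
proof -
  have "0 \<le> w \<bullet> (Rc' Y *v w)" for w
    using Rc_pos_def[OF assms(2)] by (cases "w = 0") (auto simp: pos_def_def intro: less_imp_le)
  then show ?thesis by (simp add: hamiltonian_eq_residual assms)
qed

lemma hamiltonian_mono:
  "Y \<preceq> Y' \<Longrightarrow> hamiltonian X Y v u \<le> hamiltonian X Y' v u"
  unfolding hamiltonian_def by (intro add_left_mono sum_mono loewner_le_quadratic_form)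

text \<open>With the same \<open>Y\<close> and the same feedback, the cost and noise terms cancel.
  What remains is the Lyapunov inequality for X - Z along A + B K.\<close>

lemma stabilizing_comparison:
  assumes "stable (A + B ** K)" and sym: "transpose X = X" "transpose Z = Z"
    and le: "\<And>v. hamiltonian X Y v (K *v v) \<le> hamiltonian Z Y v (K *v v)"
  shows "Z \<preceq> X"
  unfolding loewner_le_def
proof (rule lyapunov_pos_semidef[OF assms(1)])
  show "transpose (X - Z) = X - Z" by (simp add: sym transpose_diff)
  show "v \<bullet> ((X - Z) *v ((A + B ** K) *v v)) \<le> 0" for v
    using le[of v] by (simp add: hamiltonian_def matrix_vector_mult_add_rdistrib
        matrix_vector_mul_assoc[symmetric] matrix_vector_mult_diff_rdistrib inner_diff_right)
qed

text \<open>Positive semidefiniteness keeps \<open>Rc'\<close> invertible along the sequence and at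
  the limit, so the inverses converge too.\<close>

lemma tendsto_residual:
  assumes lim: "X \<longlonglongrightarrow> X'" and psd: "\<And>k. pos_semidef (X k)" "pos_semidef X'"
    and limZ: "Z \<longlonglongrightarrow> Z'"
  shows "(\<lambda>k. residual (Z k) (X k)) \<longlonglongrightarrow> residual Z' X'"
proof -
  have Rc: "(\<lambda>k. Rc' (X k)) \<longlonglongrightarrow> Rc' X'"
    unfolding Rc_def Pi22_def by (intro tendsto_intros tendsto_matrix_mult lim)
  have inv: "(\<lambda>k. matrix_inv (Rc' (X k))) \<longlonglongrightarrow> matrix_inv (Rc' X')"
    by (intro tendsto_matrix_inv Rc pos_def_invertible Rc_pos_def psd)
  have Lc: "(\<lambda>k. Lc' (X k)) \<longlonglongrightarrow> Lc' X'"
    unfolding Lc_def Pi12_def by (intro tendsto_intros tendsto_matrix_mult lim)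
  show ?thesis
    unfolding residual_def Ac_def Gc_def Hc_def Qc_def Pi11_def
    by (intro tendsto_add tendsto_diff tendsto_sum tendsto_const
        tendsto_matrix_mult tendsto_transpose lim limZ inv Lc)
qed

section \<open>The running cost, detectability and closed-loop stability\<close>

lemma cost_eq:
  assumes C: "transpose C ** C = Q - L ** matrix_inv R ** transpose L"
  shows "cost v u = (C *v v) \<bullet> (C *v v) +
    (u + matrix_inv R *v (transpose L *v v)) \<bullet> (R *v (u + matrix_inv R *v (transpose L *v v)))"
proof -
  define l where "l = transpose L *v v"
  define J where "J = matrix_inv R"
  note inv = pos_def_invertible[OF R_pos]
  have Rsym: "transpose R = R" using R_pos by (simp add: pos_def_def)
  have RJ: "R *v (J *v w) = w" for w
    by (simp add: J_def matrix_vector_mul_assoc matrix_inv_right[OF inv])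
  have L: "v \<bullet> (L *v w) = l \<bullet> w" for w
    using inner_transpose_mult[of v "transpose L" w] by (simp add: l_def del: transpose_matrix_vector)
  \<comment> \<open>The form of C^T C is that of the Schur complement of R, which is what remains of
    the cost after completing the square in \<open>u\<close>.\<close>
  have "(C *v v) \<bullet> (C *v v) = v \<bullet> ((transpose C ** C) *v v)"
    by (simp add: matrix_vector_mul_assoc[symmetric] inner_transpose_mult del: transpose_matrix_vector)
  also have "\<dots> = v \<bullet> (Q *v v) - l \<bullet> (J *v l)"
    unfolding C by (simp add: matrix_vector_mult_diff_rdistrib inner_diff_right J_def[symmetric]
        l_def[symmetric] matrix_vector_mul_assoc[symmetric] L del: transpose_matrix_vector)
  finally have C2: "(C *v v) \<bullet> (C *v v) = v \<bullet> (Q *v v) - l \<bullet> (J *v l)" .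
  show ?thesis
    unfolding l_def[symmetric] J_def[symmetric] C2 cost_def L
    using symmetric_inner[OF Rsym, of "J *v l" u]
    by (simp add: matrix_vector_right_distrib[of R] RJ inner_add_left inner_add_right
        inner_commute[of _ u] inner_commute[of l])
qed

lemma cost_nonpos_imp:
  assumes C: "transpose C ** C = Q - L ** matrix_inv R ** transpose L"
    and "cost v u \<le> 0"
  shows "C *v v = 0" "u = - (matrix_inv R *v (transpose L *v v))"
proof -
  define w where "w = u + matrix_inv R *v (transpose L *v v)"
  have Rw: "w \<noteq> 0 \<Longrightarrow> 0 < w \<bullet> (R *v w)" using R_pos by (simp add: pos_def_def)
  have le: "(C *v v) \<bullet> (C *v v) + w \<bullet> (R *v w) \<le> 0"
    using assms(2) unfolding cost_eq[OF C] w_def .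
  have "w = 0" using le Rw inner_ge_zero[of "C *v v"] by force
  then show "u = - (matrix_inv R *v (transpose L *v v))" unfolding w_def by (simp add: eq_neg_iff_add_eq_0)
  have "(C *v v) \<bullet> (C *v v) = 0" using le inner_ge_zero[of "C *v v"] \<open>w = 0\<close> by simp
  then show "C *v v = 0" by simp
qed

lemma cost_nonneg:
  assumes C: "transpose C ** C = Q - L ** matrix_inv R ** transpose L"
  shows "0 \<le> cost v u"
proof -
  have "0 \<le> w \<bullet> (R *v w)" for w
    using R_pos by (cases "w = 0") (auto simp: pos_def_def intro: less_imp_le)
  then show ?thesis unfolding cost_eq[OF C] by simp
qed

text \<open>An eigenvector with Re z >= 0 would have zero cost in its real and imaginary parts, so
  C, L^T and the feedback vanish there. It is then an eigenvector of A itself in the kernel of C,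
  against detectability.\<close>

lemma closed_loop_stable:
  assumes C: "transpose C ** C = Q - L ** matrix_inv R ** transpose L"
    and det: "detectable C A" and ker: "mat_ker C \<subseteq> mat_ker (transpose L)"
    and X: "pos_semidef X" and Ric: "Ric' X \<preceq> 0"
  shows "stable (Ac' X - Gc' X ** X)"
  unfolding stable_def closed_loop_gain
proof
  fix z assume "z \<in> spectrum (A + B ** gain X X)"
  then obtain x where x: "x \<noteq> 0" "cmat (A + B ** gain X X) *v x = z *s x"
    unfolding spectrum_def by blast
  define K where "K = gain X X"
  define a where "a = (\<chi> i. Re (x $ i))"
  define b where "b = (\<chi> i. Im (x $ i))"
  have re: "M *v a = (\<chi> i. Re ((cmat M *v x) $ i))" and im: "M *v b = (\<chi> i. Im ((cmat M *v x) $ i))"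
    for M :: "real^'n^'q::finite"
    by (simp_all add: a_def b_def cmat_def matrix_vector_mult_def vec_eq_iff)
  have a: "A *v a + B *v (K *v a) = Re z *\<^sub>R a - Im z *\<^sub>R b"
    using re[of "A + B ** K"] x(2) unfolding K_def[symmetric]
    by (simp add: matrix_vector_mult_add_rdistrib matrix_vector_mul_assoc a_def b_def vec_eq_iff)
  have b: "A *v b + B *v (K *v b) = Re z *\<^sub>R b + Im z *\<^sub>R a"
    using im[of "A + B ** K"] x(2) unfolding K_def[symmetric]
    by (simp add: matrix_vector_mult_add_rdistrib matrix_vector_mul_assoc a_def b_def vec_eq_iff)
  have Xsym: "transpose X = X" and Xnn: "0 \<le> v \<bullet> (X *v v)" for v
    using X by (auto simp: pos_semidef_def)
  \<comment> \<open>The noise sum is nonnegative as \<open>X\<close> is, so dropping it from the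
    nonpositive Hamiltonian keeps the bound.\<close>
  have bound: "2 * (v \<bullet> (X *v (A *v v + B *v (K *v v)))) + cost v (K *v v) \<le> 0" for v
  proof -
    have "hamiltonian X X v (K *v v) \<le> 0"
      using loewner_le_quadratic_form[OF Ric, of v]
      by (simp add: K_def hamiltonian_gain[OF Xsym X] Ric_eq_residual)
    moreover have "0 \<le> (\<Sum>i=1..r. (A0 i *v v + B0 i *v (K *v v)) \<bullet> (X *v (A0 i *v v + B0 i *v (K *v v))))"
      by (intro sum_nonneg Xnn)
    ultimately show ?thesis by (simp add: hamiltonian_def)
  qed
  have "z \<in> {z. Re z < 0}"
  proof (rule ccontr)
    assume "z \<notin> {z. Re z < 0}"
    then have z: "0 \<le> Re z" by simp
    \<comment> \<open>In the sum over both parts the terms with Im z cancel by symmetry of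
      \<open>X\<close>, leaving a nonnegative multiple of Re z.\<close>
    have "b \<bullet> (X *v a) = a \<bullet> (X *v b)"
      using symmetric_inner[OF Xsym, of a b] by (simp add: inner_commute)
    then have "a \<bullet> (X *v (A *v a + B *v (K *v a))) + b \<bullet> (X *v (A *v b + B *v (K *v b)))
        = Re z * (a \<bullet> (X *v a) + b \<bullet> (X *v b))"
      unfolding a b by (simp add: algebra_simps inner_simps)
    moreover have "0 \<le> Re z * (a \<bullet> (X *v a) + b \<bullet> (X *v b))"
      using z Xnn by (intro mult_nonneg_nonneg add_nonneg_nonneg)
    ultimately have "cost a (K *v a) + cost b (K *v b) \<le> 0"
      using bound[of a] bound[of b] by linarith
    then have ca: "cost a (K *v a) \<le> 0" and cb: "cost b (K *v b) \<le> 0"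
      using cost_nonneg[OF C, of a "K *v a"] cost_nonneg[OF C, of b "K *v b"] by linarith+
    have C0: "C *v a = 0" "C *v b = 0"
      using cost_nonpos_imp(1)[OF C] ca cb by blast+
    then have L0: "transpose L *v a = 0" "transpose L *v b = 0"
      using ker by (auto simp: mat_ker_def)
    have "K *v a = 0" "K *v b = 0"
      using cost_nonpos_imp(2)[OF C ca] cost_nonpos_imp(2)[OF C cb] unfolding L0 by simp_all
    then have "A *v a = Re z *\<^sub>R a - Im z *\<^sub>R b" "A *v b = Re z *\<^sub>R b + Im z *\<^sub>R a"
      using a b by simp_all
    then have "cmat A *v x = z *s x"
      unfolding re im by (simp add: vec_eq_iff complex_eq_iff a_def b_def)
    moreover have "cmat C *v x = 0"
      using C0 unfolding re im by (simp add: vec_eq_iff complex_eq_iff)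
    ultimately have "x = 0" using det z unfolding detectable_def by blast
    with x(1) show False ..
  qed
  then show "z \<in> {z. Re z < 0}" .
qed

end

section \<open>Monotonicity of the iteration and passage to the limit\<close>

theorem theorem3p4:
  fixes r :: nat
    and A :: "real^'n^'n" and A0 :: "nat \<Rightarrow> real^'n^'n"
    and B :: "real^'m^'n" and B0 :: "nat \<Rightarrow> real^'m^'n"
    and Q :: "real^'n^'n" and L :: "real^'m^'n" and R :: "real^'m^'m"
    and C :: "real^'n^'p"
    and Xhat X0 :: "real^'n^'n" and X :: "nat \<Rightarrow> real^'n^'n"
  assumes Q_sym: "transpose Q = Q"
    and R_pos: "pos_def R"
    and QLR: "0 \<preceq> Q - L ** matrix_inv R ** transpose L"
    and stab: "stabilizable A B"
    and det: "detectable C A"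
    and C_decomp: "full_rank_decomposition (Q - L ** matrix_inv R ** transpose L) C"
    and C_ker: "mat_ker C \<subseteq> (\<Inter>i\<in>{1..r}. mat_ker (A0 i)) \<inter> mat_ker (transpose L)"
    and Xhat_psd: "0 \<preceq> Xhat"
    and Xhat_sol: "Ric r A B A0 B0 Q L R Xhat = 0"
    and X0_sym: "transpose X0 = X0"
    and X0_ge: "Xhat \<preceq> X0"
    and X0_stable: "stable (Ac r A B A0 B0 L R X0 - Gc r B B0 R X0 ** X0)"
    and X0_Ric: "Ric r A B A0 B0 Q L R X0 \<preceq> 0"
    and X_0: "X 0 = X0"
    and X_Suc: "\<And>k. 0 \<preceq> X (Suc k) \<and>
                     stabilizing_care_solution
                       (Ac r A B A0 B0 L R (X k)) (Gc r B B0 R (X k)) (Hc r A0 B0 Q L R (X k))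
                       (X (Suc k))"
  shows "(\<forall>k. X (Suc k) \<preceq> X k \<and> Xhat \<preceq> X k \<and> Ric r A B A0 B0 Q L R (X k) \<preceq> 0) \<and>
         (\<exists>Xp. X \<longlonglongrightarrow> Xp \<and> Xhat \<preceq> Xp \<and> Ric r A B A0 B0 Q L R Xp = 0 \<and>
               spectrum (Ac r A B A0 B0 L R Xp - Gc r B B0 R Xp ** Xp)
                 \<subseteq> {z. Re z < 0} \<union> {z. Re z = 0})"
proof -
  interpret scare r A A0 B B0 Q L R by unfold_locales (fact Q_sym R_pos)+
  have C: "transpose C ** C = Q - L ** matrix_inv R ** transpose L"
    using C_decomp by (simp add: full_rank_decomposition_def)
  have ker: "mat_ker C \<subseteq> mat_ker (transpose L)" using C_ker by blast
  have Xhat: "pos_semidef Xhat" using Xhat_psd by (simp add: loewner_le_def)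
  then have Xhat_sym: "transpose Xhat = Xhat" by (simp add: pos_semidef_def)
  \<comment> \<open>Needed for the starting matrix, which is only assumed symmetric and above
    \<open>Xhat\<close>.\<close>
  have psd_above: "pos_semidef Z" if "Xhat \<preceq> Z" "transpose Z = Z" for Z
    using that Xhat loewner_le_quadratic_form[OF that(1)] unfolding pos_semidef_def
    by (meson order_trans)
  have psd: "pos_semidef (X k)" for k
    by (cases k) (use X_Suc psd_above[OF X0_ge X0_sym] in \<open>simp_all add: loewner_le_def X_0\<close>)
  then have sym: "transpose (X k) = X k" for k by (simp add: pos_semidef_def)
  have res: "residual (X (Suc k)) (X k) = 0" for k
    using X_Suc[of k] by (simp add: stabilizing_care_solution_def care_solution_def residual_def)
  have st: "stable (A + B ** gain (X (Suc k)) (X k))" for k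
    using X_Suc[of k] by (simp add: stabilizing_care_solution_def closed_loop_gain)
  have ham: "hamiltonian (X (Suc k)) (X k) v (gain (X (Suc k)) (X k) *v v) = 0" for k v
    by (simp add: hamiltonian_gain sym psd res)
  \<comment> \<open>Compared along the feedback of \<open>X k\<close>, which is stabilizing by
    detectability: the Hamiltonian of \<open>X k\<close> is nonpositive there, that of the next
    iterate is at least its minimum 0.\<close>
  have dec: "X (Suc k) \<preceq> X k" if Ric: "Ric' (X k) \<preceq> 0" for k
  proof (rule stabilizing_comparison)
    show "stable (A + B ** gain (X k) (X k))"
      using closed_loop_stable[OF C det ker psd Ric] by (simp add: closed_loop_gain)
    show "hamiltonian (X k) (X k) v (gain (X k) (X k) *v v)
        \<le> hamiltonian (X (Suc k)) (X k) v (gain (X k) (X k) *v v)" for v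
      using loewner_le_quadratic_form[OF Ric, of v]
        residual_le_hamiltonian[OF sym[of "Suc k"] psd[of k], of v "gain (X k) (X k) *v v"]
      by (simp add: hamiltonian_gain sym psd res Ric_eq_residual)
  qed (rule sym)+
  \<comment> \<open>Compared along the feedback of the next iterate, stabilizing by construction.
    The Hamiltonian of \<open>Xhat\<close> has minimum 0 and only grows when \<open>Y\<close> is
    raised from \<open>Xhat\<close> to \<open>X k\<close>.\<close>
  have above: "Xhat \<preceq> X (Suc k)" if "Xhat \<preceq> X k" for k
  proof (rule stabilizing_comparison[OF st sym Xhat_sym])
    fix v
    let ?u = "gain (X (Suc k)) (X k) *v v"
    have "0 \<le> hamiltonian Xhat Xhat v ?u"
      using residual_le_hamiltonian[OF Xhat_sym Xhat, of v ?u] Xhat_sol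
      by (simp add: Ric_eq_residual)
    also have "\<dots> \<le> hamiltonian Xhat (X k) v ?u" by (rule hamiltonian_mono[OF that])
    finally show "hamiltonian (X (Suc k)) (X k) v ?u \<le> hamiltonian Xhat (X k) v ?u"
      by (simp add: ham)
  qed
  \<comment> \<open>The feedback optimal for the old coefficients is a competitor for the new ones,
    and lowering \<open>Y\<close> from \<open>X k\<close> to \<open>X (Suc k)\<close> can only
    decrease its value 0.\<close>
  have Ric: "Ric' (X (Suc k)) \<preceq> 0" if "X (Suc k) \<preceq> X k" for k
    unfolding loewner_le_def pos_semidef_def
  proof (intro conjI allI)
    show "transpose (0 - Ric' (X (Suc k))) = 0 - Ric' (X (Suc k))"
      using transpose_residual[OF sym psd] transpose_diff[of 0]
      by (simp add: Ric_eq_residual transpose_def vec_eq_iff)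
    fix v
    let ?u = "gain (X (Suc k)) (X k) *v v"
    have "v \<bullet> (Ric' (X (Suc k)) *v v) \<le> hamiltonian (X (Suc k)) (X (Suc k)) v ?u"
      by (simp add: Ric_eq_residual residual_le_hamiltonian sym psd)
    also have "\<dots> \<le> hamiltonian (X (Suc k)) (X k) v ?u" by (rule hamiltonian_mono[OF that])
    finally show "0 \<le> v \<bullet> ((0 - Ric' (X (Suc k))) *v v)"
      by (simp add: ham matrix_mult_uminus)
  qed
  \<comment> \<open>A nonpositive residual at k gives the descent from k to k + 1, and this descent
    gives the nonpositive residual at k + 1.\<close>
  have inv: "Xhat \<preceq> X k \<and> Ric' (X k) \<preceq> 0" for k
    by (induction k) (use X0_ge X0_Ric above Ric dec in \<open>auto simp: X_0\<close>)
  have part1: "\<forall>k. X (Suc k) \<preceq> X k \<and> Xhat \<preceq> X k \<and> Ric' (X k) \<preceq> 0"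
    using inv dec by blast
  then obtain Xp where lim: "X \<longlonglongrightarrow> Xp"
    using loewner_decreasing_convergent[of X Xhat] sym unfolding convergent_def by blast
  have Xp: "pos_semidef Xp" by (rule pos_semidef_limit[OF lim psd])
  have Xp_above: "Xhat \<preceq> Xp"
    unfolding loewner_le_def
    by (rule pos_semidef_limit[OF tendsto_diff[OF lim tendsto_const]])
      (use part1 in \<open>simp add: loewner_le_def\<close>)
  \<comment> \<open>The unknown and the coefficients have the same limit, so the vanishing CARE
    residuals become the SCARE at \<open>Xp\<close>.\<close>
  have "(\<lambda>k. residual (X (Suc k)) (X k)) \<longlonglongrightarrow> residual Xp Xp"
    by (rule tendsto_residual[OF lim psd Xp LIMSEQ_Suc[OF lim]])
  then have sol: "Ric' Xp = 0"
    by (simp add: res Ric_eq_residual LIMSEQ_const_iff)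
  have "Ric' Xp \<preceq> 0"
    by (simp add: sol loewner_le_def pos_semidef_def transpose_def vec_eq_iff)
  from closed_loop_stable[OF C det ker Xp this] 
  have "spectrum (Ac' Xp - Gc' Xp ** Xp) \<subseteq> {z. Re z < 0} \<union> {z. Re z = 0}"
    unfolding stable_def by blast
  with part1 lim Xp_above sol show ?thesis by blast
qed

end
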